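(* Colouring the complete graph $K_n$ with a Las Vegas beeping algorithm takes $\Omega(n)$ slots, even in the strongest beeping model $B_{cd}L_{cd}$.
   Context: Beeping model: the network is a finite simple undirected graph; nodes are anonymous, have no initial knowledge about the graph (in particular not its size), all run the same randomised algorithm with independent random choices, and all start in the same slot. Time is divided into synchronous slots; in each slot every active node either beeps or listens. In $B_{cd}L_{cd}$, a beeping node learns whether at least one neighbour beeped in the same slot, and a listening node can distinguish between zero, exactly one, and at least two beeping neighbours. A Las Vegas algorithm always produces a correct result and its running time is random but finite with probability $1$. Colouring means that each node outputs a colour such that any two adjacent nodes have different colours, on every input graph. The statement concerns the number of slots until all nodes have terminated. *)

theory Defs
  imports
    "HOL-Probability.Probability"
    "HOL-Library.Landau_Symbols"
    "Graph_Theory.Kuratowski"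
begin

text \<open>
  Networks are finite simple undirected graphs, i.e. loop-free symmetric digraphs whose arcs are
  pairs (\<^locale>\<open>pair_graph\<close>). The node names serve only to write the graph down: no node has
  access to them.
\<close>

datatype 'c action = Beep | Listen | Halt 'c

datatype heard = No_beep | One_beep | Many_beeps

text \<open>
  What a node learns in one slot of the model with collision detection both for beeping nodes
  (did some neighbour beep too?) and for listening nodes (zero, one, or at least two beeps?).
\<close>

datatype observation = Beeped bool | Listened heard

definition heard_of :: "nat \<Rightarrow> heard" where
  "heard_of k = (if k = 0 then No_beep else if k = 1 then One_beep else Many_beeps)"

text \<open>
  A randomised algorithm is one function, the same at every node, of the private random value of
  the node (drawn from a probability space \<open>R\<close> and containing all the random choices that
  the node will ever make) and of the observations the node has made so far. The number of past
  slots is the length of the history. Actions already taken are determined by these data.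
  The identity and the degree of a node and the graph are not among the arguments.
\<close>

type_synonym ('r, 'c) algorithm = "'r \<Rightarrow> observation list \<Rightarrow> 'c action"

definition randomised_algorithm :: "'r measure \<Rightarrow> ('r, 'c) algorithm \<Rightarrow> bool" where
  "randomised_algorithm R A \<longleftrightarrow>
     prob_space R \<and> (\<forall>h. (\<lambda>r. A r h) \<in> measurable R (count_space UNIV))"

text \<open>
  \<open>history G A \<omega> t v\<close> is the list of observations of \<open>v\<close> in the first \<open>t\<close> slots, \<open>\<omega> u\<close>
  being the random value of node \<open>u\<close>. A halted node takes no further part: its history, hence its
  action \<open>Halt c\<close>, stays the same for ever and its neighbours hear nothing from it.
\<close>

primrec history ::
  "nat pair_pre_digraph \<Rightarrow> ('r, 'c) algorithm \<Rightarrow> (nat \<Rightarrow> 'r) \<Rightarrow> nat \<Rightarrow> nat \<Rightarrow> observation list"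
where
  "history G A \<omega> 0 v = []"
| "history G A \<omega> (Suc t) v =
     (let beeping = {u. (v, u) \<in> parcs G \<and> A (\<omega> u) (history G A \<omega> t u) = Beep} in
      case A (\<omega> v) (history G A \<omega> t v) of
        Beep \<Rightarrow> history G A \<omega> t v @ [Beeped (beeping \<noteq> {})]
      | Listen \<Rightarrow> history G A \<omega> t v @ [Listened (heard_of (card beeping))]
      | Halt c \<Rightarrow> history G A \<omega> t v)"

definition terminated_with ::
  "nat pair_pre_digraph \<Rightarrow> ('r, 'c) algorithm \<Rightarrow> (nat \<Rightarrow> 'r) \<Rightarrow> nat \<Rightarrow> (nat \<Rightarrow> 'c) \<Rightarrow> bool"
where
  "terminated_with G A \<omega> t out \<longleftrightarrow>
     (\<forall>v\<in>pverts G. A (\<omega> v) (history G A \<omega> t v) = Halt (out v))"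

text \<open>The number of slots until all nodes have halted; \<open>\<infinity>\<close> if this never happens.\<close>

definition running_time ::
  "nat pair_pre_digraph \<Rightarrow> ('r, 'c) algorithm \<Rightarrow> (nat \<Rightarrow> 'r) \<Rightarrow> enat"
where
  "running_time G A \<omega> = (INF t\<in>{t. \<exists>out. terminated_with G A \<omega> t out}. enat t)"

definition node_randomness :: "nat pair_pre_digraph \<Rightarrow> 'r measure \<Rightarrow> (nat \<Rightarrow> 'r) measure" where
  "node_randomness G R = PiM (pverts G) (\<lambda>_. R)"

definition proper_colouring :: "nat pair_pre_digraph \<Rightarrow> (nat \<Rightarrow> 'c) \<Rightarrow> bool" where
  "proper_colouring G col \<longleftrightarrow> (\<forall>(u, v)\<in>parcs G. col u \<noteq> col v)"

text \<open>
  The random choices being arbitrary (not necessarily discrete), ``always correct'' is read as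
  correct with probability 1. Colours should then come from a countable set: with real colours,
  outputting an independent uniform random number would be correct almost surely.
\<close>

definition las_vegas ::
  "(nat pair_pre_digraph \<Rightarrow> (nat \<Rightarrow> 'c) \<Rightarrow> bool) \<Rightarrow> 'r measure \<Rightarrow> ('r, 'c) algorithm \<Rightarrow> bool"
where
  "las_vegas correct R A \<longleftrightarrow> randomised_algorithm R A \<and>
     (\<forall>G. pair_graph G \<longrightarrow>
        (AE \<omega> in node_randomness G R.
           running_time G A \<omega> < \<infinity> \<and>
           (\<forall>t out. terminated_with G A \<omega> t out \<longrightarrow> correct G out)))"

end

theory Submission
  imports Defs
begin

text \<open>
  If some node \<open>u\<close> of \<open>K\<^sub>n\<close> never beeps alone before all nodes have halted, then adding a twin of
  \<open>u\<close> to the graph, which happens to make the same choices, changes no observation in \<open>K\<^sub>n\<^sub>+\<^sub>1\<close>: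
  whenever the twins beep, the other nodes heard at least one other beep already. The twins then halt
  with the same colour. The choices made up to a halting time are determined by
  countably many data, so almost surely each node made choices of positive probability, and the run
  with the twin has positive probability too, against correctness on \<open>K\<^sub>n\<^sub>+\<^sub>1\<close>. Hence almost surely
  every node beeps alone in some slot, and every slot has at most one such node.
\<close>

text \<open>Makes the finite records of observations and actions a countable type, so that almost
  sure statements can quantify over all of them.\<close>

instance action :: (countable) countable by countable_datatype
instance heard :: countable by countable_datatype
instance observation :: countable by countable_datatype

text \<open>Parametrised by the node set, so that adding a node to the network is just
  \<open>insert w V\<close>.\<close>

definition complete_pair_graph :: "'a set \<Rightarrow> 'a pair_pre_digraph" where
  "complete_pair_graph V = \<lparr>pverts = V, parcs = {(u, v). u \<in> V \<and> v \<in> V \<and> u \<noteq> v}\<rparr>"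

lemma complete_pair_graph_simps [simp]:
  "pverts (complete_pair_graph V) = V"
  "(u, v) \<in> parcs (complete_pair_graph V) \<longleftrightarrow> u \<in> V \<and> v \<in> V \<and> u \<noteq> v"
  by (auto simp: complete_pair_graph_def)

lemma complete_digraph_eq_complete_pair_graph:
  "complete_digraph n (with_proj G) \<longleftrightarrow>
     finite (pverts G) \<and> card (pverts G) = n \<and> G = complete_pair_graph (pverts G)"
  unfolding complete_digraph_pair_def by (cases G) (auto simp: complete_pair_graph_def)

lemma pair_graph_complete_pair_graph:
  assumes "finite V"
  shows "pair_graph (complete_pair_graph V)"
proof -
  have "complete_digraph (card V) (with_proj (complete_pair_graph V))"
    using assms by (simp add: complete_digraph_eq_complete_pair_graph)
  then show ?thesis
    by (rule pair_graphI_complete)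
qed

section \<open>Observations in complete graphs and the effect of a twin\<close>

definition beepers ::
  "nat pair_pre_digraph \<Rightarrow> ('r, 'c) algorithm \<Rightarrow> (nat \<Rightarrow> 'r) \<Rightarrow> nat \<Rightarrow> nat set"
where
  "beepers G A \<omega> t = {v \<in> pverts G. A (\<omega> v) (history G A \<omega> t v) = Beep}"

text \<open>All other nodes being neighbours, one global set of beepers determines every
  observation.\<close>

lemma history_complete_pair_graph_Suc:
  assumes "v \<in> V"
  shows "history (complete_pair_graph V) A \<omega> (Suc t) v =
    (case A (\<omega> v) (history (complete_pair_graph V) A \<omega> t v) of
       Beep \<Rightarrow> history (complete_pair_graph V) A \<omega> t v
         @ [Beeped (beepers (complete_pair_graph V) A \<omega> t - {v} \<noteq> {})]
     | Listen \<Rightarrow> history (complete_pair_graph V) A \<omega> t v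
         @ [Listened (heard_of (card (beepers (complete_pair_graph V) A \<omega> t - {v})))]
     | Halt c \<Rightarrow> history (complete_pair_graph V) A \<omega> t v)"
proof -
  have "{u. (v, u) \<in> parcs (complete_pair_graph V) \<and>
          A (\<omega> u) (history (complete_pair_graph V) A \<omega> t u) = Beep} =
        beepers (complete_pair_graph V) A \<omega> t - {v}"
    using assms by (auto simp: beepers_def)
  then show ?thesis
    by (simp only: history.simps Let_def)
qed

lemma heard_of_card_eq_Many_beeps:
  assumes "finite S" "x \<in> S" "y \<in> S" "x \<noteq> y"
  shows "heard_of (card S) = Many_beeps"
proof -
  have "card {x, y} \<le> card S"
    using assms by (intro card_mono) auto
  with \<open>x \<noteq> y\<close> show ?thesis
    by (simp add: heard_of_def)
qed

text \<open>The map \<open>id(w := u)\<close> folds the twin \<open>w\<close> onto \<open>u\<close>.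
  The assumption \<open>same\<close> evaluates the new random values only on histories of the old
  run, so it can be arranged before anything is known about the new run; the induction on
  \<open>s\<close> makes the two runs agree.\<close>

lemma history_with_twin:
  fixes A :: "('r, 'c) algorithm"
  defines "H \<equiv> \<lambda>V. history (complete_pair_graph V) A"
  assumes "finite V" "u \<in> V" "w \<notin> V"
    and not_alone: "\<And>s. s < t \<Longrightarrow> beepers (complete_pair_graph V) A \<omega> s \<noteq> {u}"
    and same: "\<And>v s. v \<in> insert w V \<Longrightarrow> s < t \<Longrightarrow>
      A (\<omega>' v) (H V \<omega> s ((id(w := u)) v)) = A (\<omega> ((id(w := u)) v)) (H V \<omega> s ((id(w := u)) v))"
    and "s \<le> t" "v \<in> insert w V"
  shows "H (insert w V) \<omega>' s v = H V \<omega> s ((id(w := u)) v)"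
  using \<open>s \<le> t\<close> \<open>v \<in> insert w V\<close>
proof (induction s arbitrary: v)
  case 0
  then show ?case by (simp add: H_def)
next
  case (Suc s)
  let ?\<phi> = "id(w := u)"
  let ?S = "beepers (complete_pair_graph V) A \<omega> s"
  let ?S' = "beepers (complete_pair_graph (insert w V)) A \<omega>' s"
  have act: "A (\<omega>' x) (H (insert w V) \<omega>' s x) = A (\<omega> (?\<phi> x)) (H V \<omega> s (?\<phi> x))"
    if "x \<in> insert w V" for x
    using Suc.IH[of x] same[of x s] that Suc.prems(1) by auto
  have S': "?S' = {x \<in> insert w V. ?\<phi> x \<in> ?S}"
    using act \<open>u \<in> V\<close> by (auto simp: beepers_def H_def split: if_splits)
  have SV: "?S \<subseteq> V"
    by (auto simp: beepers_def)
  then have "finite ?S"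
    using \<open>finite V\<close> finite_subset by blast
  have v: "?\<phi> v \<in> V"
    using Suc.prems(2) \<open>u \<in> V\<close> by auto
  have beep_iff: "A (\<omega> (?\<phi> v)) (H V \<omega> s (?\<phi> v)) = Beep \<longleftrightarrow> ?\<phi> v \<in> ?S"
    using v by (simp add: beepers_def H_def)
  have heard: "(?\<phi> v \<in> ?S \<longrightarrow> (?S' - {v} \<noteq> {} \<longleftrightarrow> ?S - {?\<phi> v} \<noteq> {})) \<and>
    (?\<phi> v \<notin> ?S \<longrightarrow> heard_of (card (?S' - {v})) = heard_of (card (?S - {?\<phi> v})))"
  proof (cases "u \<in> ?S")
    case False
    then have "?S' = ?S" "u \<notin> ?S" "w \<notin> ?S"
      using S' SV \<open>w \<notin> V\<close> by (auto split: if_splits)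
    then show ?thesis
      by auto
  next
    case True
    \<comment> \<open>This second beeper \<open>x\<close> is what hides the twin.\<close>
    obtain x where x: "x \<in> ?S" "x \<noteq> u"
      using not_alone[of s] Suc.prems(1) True by auto
    have S'_eq: "?S' = insert w ?S"
      using S' SV \<open>w \<notin> V\<close> True by (auto split: if_splits)
    have "x \<noteq> w" "u \<noteq> w"
      using x SV \<open>w \<notin> V\<close> \<open>u \<in> V\<close> by auto
    show ?thesis
    \<comment> \<open>A beeping node learns a single bit, which is true in both graphs. A listening
      node hears both \<open>u\<close> and \<open>x\<close> in both graphs, and counts above one are
      indistinguishable.\<close>
    proof (cases "?\<phi> v \<in> ?S")
      case True
      have "?S' - {v} \<noteq> {}" "?S - {?\<phi> v} \<noteq> {}"
        using S'_eq x \<open>u \<in> ?S\<close> \<open>u \<noteq> w\<close> \<open>x \<noteq> w\<close> by auto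
      then show ?thesis
        using True by blast
    next
      case False
      then have "v \<noteq> w" "v \<notin> ?S"
        using \<open>u \<in> ?S\<close> by (auto split: if_splits)
      then have "heard_of (card (?S' - {v})) = Many_beeps"
        using S'_eq \<open>finite ?S\<close> x \<open>u \<in> ?S\<close> by (intro heard_of_card_eq_Many_beeps[of _ x u]) auto
      moreover have "heard_of (card (?S - {?\<phi> v})) = Many_beeps"
        using \<open>finite ?S\<close> x \<open>u \<in> ?S\<close> False by (intro heard_of_card_eq_Many_beeps[of _ x u]) auto
      ultimately show ?thesis
        using False by simp
    qed
  qed
  have hist: "H (insert w V) \<omega>' s v = H V \<omega> s (?\<phi> v)"
    using Suc by simp
  have act_v: "A (\<omega>' v) (H V \<omega> s (?\<phi> v)) = A (\<omega> (?\<phi> v)) (H V \<omega> s (?\<phi> v))"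
    using act[OF Suc.prems(2)] hist by simp
  show ?case
    using heard beep_iff hist act_v
    unfolding H_def history_complete_pair_graph_Suc[OF Suc.prems(2)]
      history_complete_pair_graph_Suc[OF v]
    by (cases "A (\<omega> (?\<phi> v)) (H V \<omega> s (?\<phi> v))") (simp_all add: H_def del: fun_upd_apply)
qed

section \<open>Choices of positive probability\<close>

text \<open>A single random value may have probability 0; this event fixes only finitely many of the
  choices it encodes.\<close>

definition consistent_with ::
  "'r measure \<Rightarrow> ('r, 'c) algorithm \<Rightarrow> (observation list \<times> 'c action) list \<Rightarrow> 'r set"
where
  "consistent_with R A L = {r \<in> space R. \<forall>(h, a)\<in>set L. A r h = a}"

lemma sets_consistent_with:
  assumes "randomised_algorithm R A"
  shows "consistent_with R A L \<in> sets R"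
proof -
  have [measurable]: "(\<lambda>r. A r h) \<in> measurable R (count_space UNIV)" for h
    using assms by (simp add: randomised_algorithm_def)
  show ?thesis
    unfolding consistent_with_def case_prod_beta by measurable
qed

text \<open>The events of probability 0 among these are countably many, so their union is null. This
  is where countability of the colours enters.\<close>

lemma AE_consistent_with_pos:
  fixes A :: "('r, 'c::countable) algorithm"
  assumes "randomised_algorithm R A"
  shows "AE r in R. \<forall>L. r \<in> consistent_with R A L \<longrightarrow> emeasure R (consistent_with R A L) > 0"
  unfolding AE_all_countable
proof
  fix L :: "(observation list \<times> 'c action) list"
  show "AE r in R. r \<in> consistent_with R A L \<longrightarrow> emeasure R (consistent_with R A L) > 0"
  proof (cases "emeasure R (consistent_with R A L) = 0")
    case True
    then have "consistent_with R A L \<in> null_sets R"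
      using sets_consistent_with[OF assms] by (simp add: null_sets_def)
    then show ?thesis
      using AE_not_in by fastforce
  qed (simp add: zero_less_iff_neq_zero)
qed

text \<open>Slot \<open>t\<close> is included, so that the final action, and with it the colour, is
  recorded.\<close>

definition transcript ::
  "nat pair_pre_digraph \<Rightarrow> ('r, 'c) algorithm \<Rightarrow> (nat \<Rightarrow> 'r) \<Rightarrow> nat \<Rightarrow> nat
    \<Rightarrow> (observation list \<times> 'c action) list"
where
  "transcript G A \<omega> t v = map (\<lambda>s. (history G A \<omega> s v, A (\<omega> v) (history G A \<omega> s v))) [0..<Suc t]"

lemma consistent_with_transcriptD:
  assumes "r \<in> consistent_with R A (transcript G A \<omega> t v)" "s \<le> t"
  shows "A r (history G A \<omega> s v) = A (\<omega> v) (history G A \<omega> s v)"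
  using assms by (auto simp: consistent_with_def transcript_def simp del: upt_Suc)

lemma consistent_with_transcript_self:
  assumes "\<omega> v \<in> space R"
  shows "\<omega> v \<in> consistent_with R A (transcript G A \<omega> t v)"
  using assms by (auto simp: consistent_with_def transcript_def)

text \<open>By independence the box has as measure a finite product of positive factors, so it
  cannot lie inside the exceptional null set.\<close>

lemma AE_PiM_box_ex:
  assumes "prob_space R" "finite V"
    and C: "\<And>v. v \<in> V \<Longrightarrow> C v \<in> sets R" "\<And>v. v \<in> V \<Longrightarrow> emeasure R (C v) > 0"
    and AE: "AE \<omega> in PiM V (\<lambda>_. R). P \<omega>"
  shows "\<exists>\<omega>\<in>PiE V C. P \<omega>"
proof (rule ccontr)
  assume none: "\<not> ?thesis"
  interpret prob_space R by fact
  interpret product_sigma_finite "\<lambda>_. R" by unfold_locales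
  have "AE \<omega> in PiM V (\<lambda>_. R). \<omega> \<notin> PiE V C"
    using AE none by (auto elim: eventually_mono)
  moreover have "PiE V C \<in> sets (PiM V (\<lambda>_. R))"
    using C(1) \<open>finite V\<close> by (intro sets_PiM_I_finite) auto
  ultimately have "emeasure (PiM V (\<lambda>_. R)) (PiE V C) = 0"
    by (simp add: AE_iff_null_sets null_setsD1)
  then have "\<exists>v\<in>V. emeasure R (C v) = 0"
    using C(1) \<open>finite V\<close> by (simp add: emeasure_PiM)
  then show False
    using C(2) by fastforce
qed

lemma every_node_beeps_alone:
  fixes A :: "('r, 'c) algorithm"
  assumes "las_vegas proper_colouring R A" "finite V" "u \<in> V"
    and pos: "\<And>v. v \<in> V \<Longrightarrow>
      emeasure R (consistent_with R A (transcript (complete_pair_graph V) A \<omega> t v)) > 0"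
    and halted: "terminated_with (complete_pair_graph V) A \<omega> t out"
  shows "\<exists>s<t. beepers (complete_pair_graph V) A \<omega> s = {u}"
proof (rule ccontr)
  assume not_alone: "\<not> ?thesis"
  have alg: "randomised_algorithm R A"
    using assms(1) by (simp add: las_vegas_def)
  obtain w where w: "w \<notin> V"
    using \<open>finite V\<close> infinite_UNIV_nat ex_new_if_finite by blast
  let ?G = "complete_pair_graph V" and ?G' = "complete_pair_graph (insert w V)"
  let ?\<phi> = "id(w := u)"
  \<comment> \<open>The twin has to repeat the recorded choices of \<open>u\<close>. Its draw is
    independent of that of \<open>u\<close>, so this restricts one more coordinate to an event of
    positive probability.\<close>
  let ?C = "\<lambda>v. consistent_with R A (transcript ?G A \<omega> t (?\<phi> v))"
  have "AE \<omega>' in node_randomness ?G' R. running_time ?G' A \<omega>' < \<infinity> \<and>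
      (\<forall>t out. terminated_with ?G' A \<omega>' t out \<longrightarrow> proper_colouring ?G' out)"
    using assms(1) pair_graph_complete_pair_graph[of "insert w V"] \<open>finite V\<close>
    unfolding las_vegas_def by blast
  then have "AE \<omega>' in PiM (insert w V) (\<lambda>_. R).
      \<forall>t out. terminated_with ?G' A \<omega>' t out \<longrightarrow> proper_colouring ?G' out"
    unfolding node_randomness_def complete_pair_graph_simps(1) by (rule eventually_mono) blast
  then have "\<exists>\<omega>'\<in>PiE (insert w V) ?C.
      \<forall>t out. terminated_with ?G' A \<omega>' t out \<longrightarrow> proper_colouring ?G' out"
    using alg \<open>finite V\<close> \<open>u \<in> V\<close> pos
    by (intro AE_PiM_box_ex[where R = R])
      (auto simp: randomised_algorithm_def intro!: sets_consistent_with)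
  then obtain \<omega>' where \<omega>': "\<omega>' \<in> PiE (insert w V) ?C"
    and correct: "terminated_with ?G' A \<omega>' t (out \<circ> ?\<phi>) \<Longrightarrow> proper_colouring ?G' (out \<circ> ?\<phi>)"
    by blast
  have same: "A (\<omega>' v) (history ?G A \<omega> s (?\<phi> v)) = A (\<omega> (?\<phi> v)) (history ?G A \<omega> s (?\<phi> v))"
    if "v \<in> insert w V" "s \<le> t" for v s
    using consistent_with_transcriptD[OF PiE_mem[OF \<omega>' that(1)] that(2)] .
  have hist: "history ?G' A \<omega>' t v = history ?G A \<omega> t (?\<phi> v)" if "v \<in> insert w V" for v
    using history_with_twin[of V u w t A \<omega> \<omega>' t v] \<open>finite V\<close> \<open>u \<in> V\<close> w not_alone same that
    by (simp del: fun_upd_apply)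
  have "A (\<omega>' v) (history ?G' A \<omega>' t v) = Halt ((out \<circ> ?\<phi>) v)" if "v \<in> insert w V" for v
  proof -
    have "?\<phi> v \<in> V"
      using that \<open>u \<in> V\<close> by auto
    then show ?thesis
      using hist[OF that] same[OF that order_refl] halted by (simp add: terminated_with_def)
  qed
  then have "terminated_with ?G' A \<omega>' t (out \<circ> ?\<phi>)"
    by (simp add: terminated_with_def)
  \<comment> \<open>The twins are adjacent, yet both output \<open>out u\<close>.\<close>
  from correct[OF this] have "(out \<circ> ?\<phi>) u \<noteq> (out \<circ> ?\<phi>) w"
    using \<open>u \<in> V\<close> w unfolding proper_colouring_def by fastforce
  then show False
    by (auto split: if_splits)
qed

section \<open>Counting slots with a single beeper\<close>

text \<open>Pigeonhole: a slot with a single beeper determines that node, so choosing such a slot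
  for each node is injective into the \<open>t\<close> slots before time \<open>t\<close>.\<close>

lemma card_le_if_each_node_beeps_alone:
  assumes "finite V" "\<And>u. u \<in> V \<Longrightarrow> \<exists>s<t. beepers G A \<omega> s = {u}"
  shows "card V \<le> t"
proof -
  obtain slot where slot: "\<And>u. u \<in> V \<Longrightarrow> slot u < t \<and> beepers G A \<omega> (slot u) = {u}"
    using assms(2) by metis
  then have "inj_on slot V"
    by (metis inj_onI singleton_inject)
  then show ?thesis
    using card_inj_on_le[of slot V "{..<t}"] slot by auto
qed

lemma AE_card_le_running_time:
  fixes A :: "('r, 'c::countable) algorithm"
  assumes lv: "las_vegas proper_colouring R A" and "finite V"
  shows "AE \<omega> in node_randomness (complete_pair_graph V) R.
    enat (card V) \<le> running_time (complete_pair_graph V) A \<omega>"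
proof -
  have alg: "randomised_algorithm R A"
    using lv by (simp add: las_vegas_def)
  \<comment> \<open>All \<open>L\<close> are treated at once because the transcripts depend on
    \<omega>; the exceptional set is then the same for every halting time.\<close>
  have "AE \<omega> in PiM V (\<lambda>_. R). \<forall>v\<in>V. \<forall>L.
      \<omega> v \<in> consistent_with R A L \<longrightarrow> emeasure R (consistent_with R A L) > 0"
    using alg \<open>finite V\<close> AE_consistent_with_pos[OF alg]
    by (intro AE_finite_allI AE_PiM_component) (auto simp: randomised_algorithm_def)
  moreover have "AE \<omega> in PiM V (\<lambda>_. R). \<omega> \<in> space (PiM V (\<lambda>_. R))"
    by (rule AE_space)
  ultimately show ?thesis
    unfolding node_randomness_def complete_pair_graph_simps(1)
  proof eventually_elim
    case (elim \<omega>)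
    have "card V \<le> t" if "terminated_with (complete_pair_graph V) A \<omega> t out" for t out
    proof (rule card_le_if_each_node_beeps_alone[OF \<open>finite V\<close>])
      fix u assume "u \<in> V"
      have "emeasure R (consistent_with R A (transcript (complete_pair_graph V) A \<omega> t v)) > 0"
        if "v \<in> V" for v
        using elim that by (auto simp: space_PiM intro!: consistent_with_transcript_self)
      then show "\<exists>s<t. beepers (complete_pair_graph V) A \<omega> s = {u}"
        using every_node_beeps_alone[OF lv \<open>finite V\<close> \<open>u \<in> V\<close> _ that] by blast
    qed
    then show ?case
      \<comment> \<open>It suffices to bound each halting time; if there is none, the infimum is
        \<infinity>.\<close>
      unfolding running_time_def by (intro INF_greatest) auto
  qed
qed

theorem lemma6:
  shows "\<exists>f :: nat \<Rightarrow> nat. (\<lambda>n. real (f n)) \<in> \<Omega>(\<lambda>n. real n) \<and>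
    (\<forall>(R :: 'r measure) (A :: ('r, 'c::countable) algorithm).
       las_vegas proper_colouring R A \<longrightarrow>
       (\<forall>n G. complete_digraph n (with_proj G) \<longrightarrow>
          (AE \<omega> in node_randomness G R. enat (f n) \<le> running_time G A \<omega>)))"
\<comment> \<open>One slot per node gives the explicit bound of \<open>n\<close> slots.\<close>
proof (intro exI[of _ "\<lambda>n. n"] conjI allI impI)
  fix R :: "'r measure" and A :: "('r, 'c) algorithm" and n
    and G :: "nat pair_pre_digraph"
  assume lv: "las_vegas proper_colouring R A" and "complete_digraph n (with_proj G)"
  then have "finite (pverts G)" "card (pverts G) = n" "G = complete_pair_graph (pverts G)"
    by (simp_all add: complete_digraph_eq_complete_pair_graph)
  then show "AE \<omega> in node_randomness G R. enat n \<le> running_time G A \<omega>"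
    using AE_card_le_running_time[OF lv, of "pverts G"] by metis
qed simp

end
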